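(* There is an equilibrium for the Orientation problem for any prior $\sigma$ on $n$ with any support, including an infinite support.
   Context: **Network and agents.** The network is a bidirectional, 2-vertex-connected graph $G=(V,E)$ with $n$ nodes ($n$ always denotes the actual number of nodes). Each node is an agent with unlimited computational power. Agents communicate over edges in synchronous rounds and all start at round $0$. Initially each agent knows its own id and private input (including its preference), but not those of other agents. Private information comes from a finite set, and each agent's prior over the private information of the others is uniform. The agents do not know $n$ but know a prior $\sigma$ on $\mathbb{N}$ with $n\sim\sigma$. The prior has *infinite support* if there is $n_0$ such that $\Pr[n=x]>0$ for all $x>n_0$. **Outputs and utilities.** Agent $a$ outputs $o_a$ ($\bot$ means it aborts). Output vectors are $O=(o_1,\dots,o_n)\in\Theta=\Theta_L\sqcup\Theta_E$, where $\Theta_L$ is the set of legal and $\Theta_E$ the set of erroneous output vectors. Each agent $a$ has a preferred output value $p_a$ and utility $u_a(O)=1$ if $o_a=p_a$ and $O\in\Theta_L$, and $u_a(O)=0$ otherwise. An agent that detects that another agent deviated outputs $\bot$, which makes the output erroneous. **Equilibrium.** For a step $s$ (the entire operation of an agent in one round) of agent $a$ at round $r$ of an execution, $\mathbb{E}_{s,r}[u_a]=\sum_{O\in\Theta}x_O(s,r)u_a(O)$, where $x_O(s,r)$ is the probability, estimated by $a$ at round $r$, that $O$ is output if $a$ takes step $s$ and all other agents follow the algorithm. An algorithm $\Lambda$ whose next step at round $r$ is $s(r)$ is a (distributed) equilibrium if for every agent $a$, every round $r$ of every possible execution in which all steps up to round $r$ were according to $\Lambda$, and every deviating step $\bar s$: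 $\mathbb{E}_{s(r),r}[u_a]\ge \mathbb{E}_{\bar s,r}[u_a]$. Only a single agent deviates (no coalitions). An "equilibrium for a problem" is an algorithm solving the problem that is an equilibrium. **Duplication (Sybil attack).** A deviating agent may pretend to be $d$ agents, by simulating $d$ imaginary agents with fake ids and distributing its edges among them. The other agents then execute the algorithm as if on the enlarged graph, of size $n+d-1$. Fake id collisions are disregarded. The cheater still produces a single output, and legality is judged on the output vector of the $n$ real agents. **Orientation.** The two ends of each edge must agree on a direction for the edge (each agent outputs a direction for each of its edges; the output is legal iff for every edge the two endpoints output the same direction). An agent prefers certain directions for its edges. *)

theory Defs
  imports "HOL-Probability.Probability"
begin

section \<open>Networks\<close>

text \<open>
  Nodes are the numbers below \<open>net_size N\<close>; an agent addresses its edges by ports, the numbers below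
  its degree.  \<open>peer N (v, p) = (u, q)\<close> says that port \<open>p\<close> of \<open>v\<close> and port \<open>q\<close> of \<open>u\<close> are the two
  ends of one edge.  Node numbers are names used by the model only: agents never see them.
\<close>

record network =
  net_size :: nat
  deg :: "nat \<Rightarrow> nat"
  peer :: "nat \<times> nat \<Rightarrow> nat \<times> nat"

definition half_edges :: "network \<Rightarrow> (nat \<times> nat) set" where
  "half_edges N = (SIGMA v:{..<net_size N}. {..<deg N v})"

text \<open>\<open>l\<close> pairs up the half-edges in \<open>P\<close>, without loops and without parallel edges.\<close>

definition simple_links :: "(nat \<times> nat) set \<Rightarrow> (nat \<times> nat \<Rightarrow> nat \<times> nat) \<Rightarrow> bool" where
  "simple_links P l \<longleftrightarrow>
     (\<forall>x\<in>P. l x \<in> P \<and> l (l x) = x \<and> fst (l x) \<noteq> fst x) \<and>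
     inj_on (\<lambda>x. (fst x, fst (l x))) P"

definition edges :: "network \<Rightarrow> (nat \<times> nat) set" where
  "edges N = (\<lambda>x. (fst x, fst (peer N x))) ` half_edges N"

definition connected_without :: "network \<Rightarrow> nat set \<Rightarrow> bool" where
  "connected_without N X \<longleftrightarrow>
     (let W = {..<net_size N} - X in \<forall>u\<in>W. \<forall>v\<in>W. (u, v) \<in> (edges N \<inter> W \<times> W)\<^sup>*)"

text \<open>
  A finite simple bidirectional graph that is connected and has no cut vertex.  On three or more
  nodes this is 2-vertex-connectedness; the single node and the single edge are admitted as well,
  so that every positive number is the size of some network.
\<close>

definition two_connected_network :: "network \<Rightarrow> bool" where
  "two_connected_network N \<longleftrightarrow>
     net_size N > 0 \<and> simple_links (half_edges N) (peer N) \<and>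
     connected_without N {} \<and> (\<forall>w<net_size N. connected_without N {w})"


section \<open>Agents and honest executions\<close>

text \<open>
  The direction of an edge as output at one of its ends: away from the agent (\<open>Outward\<close>) or
  towards it.  \<open>Orient ds\<close> assigns \<open>ds ! p\<close> to port \<open>p\<close>.
\<close>

datatype direction = Outward | Inward

datatype result = Abort | Orient "direction list"

type_synonym message = "nat list"

text \<open>
  One step: the messages to be sent on ports 0, 1, ... (nothing is sent, that is \<open>[]\<close>, on ports
  beyond the list), and possibly an output.
\<close>

record action =
  sent :: "message list"
  decision :: "result option"

definition idle :: action where
  "idle = \<lparr>sent = [], decision = None\<rparr>"

definition message_on :: "action \<Rightarrow> nat \<Rightarrow> message" where
  "message_on a p = (if p < length (sent a) then sent a ! p else [])"

text \<open>
  All that an agent knows: its id, its number of ports, its preferred output and, for every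
  completed round, its own step and the messages received, port by port.
\<close>

record view =
  ident :: nat
  ports :: nat
  preferred :: "direction list"
  history :: "(action \<times> message list) list"

text \<open>
  A (randomised) algorithm.  It is run by every agent and sees nothing but the agent's view; in
  particular it does not see the size of the network.
\<close>

type_synonym algorithm = "view \<Rightarrow> action pmf"

text \<open>The first output is final.\<close>

definition decided :: "view \<Rightarrow> result option" where
  "decided h = (case filter (\<lambda>d. d \<noteq> None) (map (decision \<circ> fst) (history h)) of
                  [] \<Rightarrow> None | d # _ \<Rightarrow> d)"

definition exchange ::
    "network \<Rightarrow> (nat \<Rightarrow> action) \<Rightarrow> (nat \<Rightarrow> view) \<Rightarrow> (nat \<Rightarrow> view)" where
  "exchange N act st = (\<lambda>v.
     if v < net_size N
     then st v\<lparr>history := history (st v) @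
                [(act v, map (\<lambda>p. case peer N (v, p) of (u, q) \<Rightarrow> message_on (act u) q)
                             [0..<deg N v])]\<rparr>
     else st v)"

primrec honest_run ::
    "algorithm \<Rightarrow> network \<Rightarrow> nat \<Rightarrow> (nat \<Rightarrow> view) \<Rightarrow> (nat \<Rightarrow> view) pmf" where
  "honest_run \<Lambda> N 0 st = return_pmf st"
| "honest_run \<Lambda> N (Suc t) st =
     do { st' \<leftarrow> honest_run \<Lambda> N t st;
          act \<leftarrow> Pi_pmf {..<net_size N} idle (\<lambda>v. \<Lambda> (st' v));
          return_pmf (exchange N act st') }"

text \<open>
  Private information: distinct ids from a finite set, which may depend on the size of the network
  (no fixed finite set suffices for all sizes), and one preferred direction for each own edge.
\<close>

type_synonym profile = "nat \<Rightarrow> nat \<times> direction list"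

definition profiles :: "(nat \<Rightarrow> nat set) \<Rightarrow> network \<Rightarrow> profile set" where
  "profiles ids N =
     {prof \<in> (\<Pi>\<^sub>E v\<in>{..<net_size N}. ids (net_size N) \<times> {ds. length ds = deg N v}).
        inj_on (\<lambda>v. fst (prof v)) {..<net_size N}}"

definition initial :: "network \<Rightarrow> profile \<Rightarrow> (nat \<Rightarrow> view)" where
  "initial N prof =
     (\<lambda>v. \<lparr>ident = fst (prof v), ports = deg N v, preferred = snd (prof v), history = []\<rparr>)"


section \<open>The Orientation problem and utilities\<close>

text \<open>An output vector; \<open>None\<close> stands for an agent that has not yet produced an output.\<close>

type_synonym outputs = "nat \<Rightarrow> result option"

text \<open>The directed edge (tail, head) that the owner of a half-edge declares for it.\<close>

definition declared :: "network \<Rightarrow> (nat \<Rightarrow> direction list) \<Rightarrow> nat \<times> nat \<Rightarrow> nat \<times> nat" where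
  "declared N D x =
     (case D (fst x) ! snd x of
        Outward \<Rightarrow> (fst x, fst (peer N x))
      | Inward \<Rightarrow> (fst (peer N x), fst x))"

definition legal :: "network \<Rightarrow> outputs \<Rightarrow> bool" where
  "legal N out \<longleftrightarrow>
     (\<exists>D. (\<forall>v<net_size N. out v = Some (Orient (D v)) \<and> length (D v) = deg N v) \<and>
          (\<forall>x\<in>half_edges N. declared N D x = declared N D (peer N x)))"

definition utility :: "network \<Rightarrow> nat \<Rightarrow> direction list \<Rightarrow> outputs \<Rightarrow> real" where
  "utility N a p out = (if out a = Some (Orient p) \<and> legal N out then 1 else 0)"

text \<open>
  Since outputs are final, the events below grow with the number of rounds, so the supremum is the
  probability that the eventual output vector is legal.  Its being 1 means that all agents output
  with probability 1 and that no execution has an erroneous output vector.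
\<close>

definition solves_orientation :: "nat pmf \<Rightarrow> (nat \<Rightarrow> nat set) \<Rightarrow> algorithm \<Rightarrow> bool" where
  "solves_orientation \<sigma> ids \<Lambda> \<longleftrightarrow>
     (\<forall>N prof. two_connected_network N \<and> net_size N \<in> set_pmf \<sigma> \<and> prof \<in> profiles ids N \<longrightarrow>
        (SUP t. measure_pmf.prob (honest_run \<Lambda> N t (initial N prof))
                  {st. legal N (\<lambda>v. decided (st v))}) = 1)"

text \<open>
  A view that occurs in no honest execution proves to an honest agent that some other
  agent deviated; an agent with such a view that has not yet produced its output aborts.
\<close>

definition honest_views :: "nat pmf \<Rightarrow> (nat \<Rightarrow> nat set) \<Rightarrow> algorithm \<Rightarrow> view set" where
  "honest_views \<sigma> ids \<Lambda> =
     {st v | N prof t st v.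
        two_connected_network N \<and> net_size N \<in> set_pmf \<sigma> \<and> prof \<in> profiles ids N \<and>
        st \<in> set_pmf (honest_run \<Lambda> N t (initial N prof)) \<and> v < net_size N}"

definition aborts_on_detection :: "nat pmf \<Rightarrow> (nat \<Rightarrow> nat set) \<Rightarrow> algorithm \<Rightarrow> bool" where
  "aborts_on_detection \<sigma> ids \<Lambda> \<longleftrightarrow>
     (\<forall>h. h \<notin> honest_views \<sigma> ids \<Lambda> \<and> decided h = None \<longrightarrow>
        (\<forall>act\<in>set_pmf (\<Lambda> h). decision act = Some Abort))"


section \<open>Deviations with duplication\<close>

text \<open>
  A deviation by an agent with \<open>k\<close> ports.  From the current round on, the agent pretends to be the
  \<open>d = length (imaginary A)\<close> agents whose views (with fake ids, and with an invented past if the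
  deviation starts late) are listed in \<open>imaginary A\<close>.  Its real port \<open>p\<close> is handed to port \<open>j\<close> of
  imaginary agent \<open>i\<close> if \<open>assign A p = (i, j)\<close>; the remaining ports of imaginary agents are linked
  among each other by \<open>inner_link A\<close>.  All imaginary agents are controlled jointly: \<open>control A\<close> maps the
  list of their views to their steps and to an output of the cheater.  The \<open>decision\<close> fields of the
  imaginary steps have no effect: the cheater has a single output.

  With \<open>d = 1\<close> these are the arbitrary deviations without duplication, among them taking one
  deviating step and following the algorithm afterwards.  As an attack is chosen depending on the
  cheater's view, the true past needs no separate argument.
\<close>

record attack =
  imaginary :: "view list"
  assign :: "nat \<Rightarrow> nat \<times> nat"
  inner_link :: "nat \<times> nat \<Rightarrow> nat \<times> nat"
  control :: "view list \<Rightarrow> ((nat \<Rightarrow> action) \<times> result option) pmf"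

definition imaginary_half_edges :: "attack \<Rightarrow> (nat \<times> nat) set" where
  "imaginary_half_edges A = (SIGMA i:{..<length (imaginary A)}. {..<ports (imaginary A ! i)})"

definition valid_attack :: "nat \<Rightarrow> attack \<Rightarrow> bool" where
  "valid_attack k A \<longleftrightarrow>
     imaginary A \<noteq> [] \<and>
     inj_on (assign A) {..<k} \<and> assign A ` {..<k} \<subseteq> imaginary_half_edges A \<and>
     simple_links (imaginary_half_edges A - assign A ` {..<k}) (inner_link A)"

text \<open>
  The enlarged network, of size \<open>n + d - 1\<close>: imaginary agent 0 takes the place of the cheater \<open>c\<close>,
  the others get the new node names \<open>n, n + 1, ...\<close>.
\<close>

definition node_of :: "network \<Rightarrow> nat \<Rightarrow> nat \<Rightarrow> nat" where
  "node_of N c i = (if i = 0 then c else net_size N + i - 1)"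

definition index_of :: "network \<Rightarrow> nat \<Rightarrow> nat \<Rightarrow> nat" where
  "index_of N c v = (if v = c then 0 else v - net_size N + 1)"

definition is_imaginary :: "network \<Rightarrow> nat \<Rightarrow> nat \<Rightarrow> bool" where
  "is_imaginary N c v \<longleftrightarrow> v = c \<or> v \<ge> net_size N"

definition enlarge :: "network \<Rightarrow> nat \<Rightarrow> attack \<Rightarrow> network" where
  "enlarge N c A =
     \<lparr>net_size = net_size N + length (imaginary A) - 1,
      deg = (\<lambda>v. if is_imaginary N c v then ports (imaginary A ! index_of N c v) else deg N v),
      peer = (\<lambda>(v, p).
        if is_imaginary N c v then
          (let x = (index_of N c v, p) in
           if x \<in> assign A ` {..<deg N c}
           then peer N (c, the_inv_into {..<deg N c} (assign A) x)
           else (node_of N c (fst (inner_link A x)), snd (inner_link A x)))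
        else
          (case peer N (v, p) of (u, q) \<Rightarrow>
             if u = c then (node_of N c (fst (assign A q)), snd (assign A q)) else (u, q)))\<rparr>"

text \<open>
  The state of an attacked execution consists of the views of all agents of the enlarged network
  and the output of the cheater, final as well.  All real agents but the cheater run the algorithm.
\<close>

type_synonym attacked_state = "(nat \<Rightarrow> view) \<times> result option"

definition attack_start ::
    "network \<Rightarrow> nat \<Rightarrow> attack \<Rightarrow> (nat \<Rightarrow> view) \<Rightarrow> attacked_state" where
  "attack_start N c A st =
     ((\<lambda>v. if is_imaginary N c v then imaginary A ! index_of N c v else st v), decided (st c))"

definition attack_round ::
    "algorithm \<Rightarrow> network \<Rightarrow> nat \<Rightarrow> attack \<Rightarrow> attacked_state \<Rightarrow> attacked_state pmf" where
  "attack_round \<Lambda> N c A s =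
     do { hon \<leftarrow> Pi_pmf ({..<net_size N} - {c}) idle (\<lambda>v. \<Lambda> (fst s v));
          (img, d) \<leftarrow> control A (map (\<lambda>i. fst s (node_of N c i)) [0..<length (imaginary A)]);
          return_pmf
            (exchange (enlarge N c A)
               (\<lambda>v. if is_imaginary N c v then img (index_of N c v) else hon v) (fst s),
             case snd s of None \<Rightarrow> d | Some d' \<Rightarrow> Some d') }"

primrec attack_run ::
    "algorithm \<Rightarrow> network \<Rightarrow> nat \<Rightarrow> attack \<Rightarrow> nat \<Rightarrow> attacked_state \<Rightarrow> attacked_state pmf" where
  "attack_run \<Lambda> N c A 0 s = return_pmf s"
| "attack_run \<Lambda> N c A (Suc t) s = attack_run \<Lambda> N c A t s \<bind> attack_round \<Lambda> N c A"

text \<open>The outputs of the \<open>n\<close> real agents.\<close>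

definition attack_outputs :: "nat \<Rightarrow> attacked_state \<Rightarrow> outputs" where
  "attack_outputs c s = (\<lambda>v. if v = c then snd s else decided (fst s v))"


section \<open>Equilibrium\<close>

text \<open>
  What an agent believes, before the start, about the network and about its own place in it,
  conditional on the network having \<open>n\<close> nodes.
\<close>

type_synonym topology_prior = "nat \<Rightarrow> (network \<times> nat) pmf"

definition topology_prior :: "nat pmf \<Rightarrow> topology_prior \<Rightarrow> bool" where
  "topology_prior \<sigma> \<tau> \<longleftrightarrow>
     (\<forall>n\<in>set_pmf \<sigma>. \<forall>(N, a)\<in>set_pmf (\<tau> n). two_connected_network N \<and> net_size N = n \<and> a < n)"

text \<open>
  The prior joint distribution of the network, the agent's place in it, and the state after \<open>r\<close>
  rounds in which all agents followed the algorithm: the size is distributed according to \<open>\<sigma>\<close>, the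
  private information uniformly.
\<close>

definition honest_play ::
    "nat pmf \<Rightarrow> topology_prior \<Rightarrow> (nat \<Rightarrow> nat set) \<Rightarrow> algorithm \<Rightarrow> nat
       \<Rightarrow> (network \<times> nat \<times> (nat \<Rightarrow> view)) pmf" where
  "honest_play \<sigma> \<tau> ids \<Lambda> r =
     do { n \<leftarrow> \<sigma>;
          (N, a) \<leftarrow> \<tau> n;
          prof \<leftarrow> pmf_of_set (profiles ids N);
          st \<leftarrow> honest_run \<Lambda> N r (initial N prof);
          return_pmf (N, a, st) }"

definition own_view :: "network \<times> nat \<times> (nat \<Rightarrow> view) \<Rightarrow> view" where
  "own_view = (\<lambda>(N, a, st). st a)"

definition posterior ::
    "nat pmf \<Rightarrow> topology_prior \<Rightarrow> (nat \<Rightarrow> nat set) \<Rightarrow> algorithm \<Rightarrow> nat \<Rightarrow> view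
       \<Rightarrow> (network \<times> nat \<times> (nat \<Rightarrow> view)) pmf" where
  "posterior \<sigma> \<tau> ids \<Lambda> r h = cond_pmf (honest_play \<sigma> \<tau> ids \<Lambda> r) {s. own_view s = h}"

text \<open>
  The expected utility, estimated at round \<open>r\<close> by an agent with view \<open>h\<close>, if it goes on to follow
  the algorithm or to perform an attack.  An incomplete output vector has utility 0 and outputs are
  final, so the expectations grow with \<open>t\<close>, and the supremum is the expected utility of the eventual
  output vector.
\<close>

definition honest_utility ::
    "nat pmf \<Rightarrow> topology_prior \<Rightarrow> (nat \<Rightarrow> nat set) \<Rightarrow> algorithm \<Rightarrow> nat \<Rightarrow> view \<Rightarrow> real" where
  "honest_utility \<sigma> \<tau> ids \<Lambda> r h =
     (SUP t. measure_pmf.expectation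
        (do { (N, a, st) \<leftarrow> posterior \<sigma> \<tau> ids \<Lambda> r h;
              st' \<leftarrow> honest_run \<Lambda> N t st;
              return_pmf (utility N a (preferred h) (\<lambda>v. decided (st' v))) })
        (\<lambda>x. x))"

definition attack_utility ::
    "nat pmf \<Rightarrow> topology_prior \<Rightarrow> (nat \<Rightarrow> nat set) \<Rightarrow> algorithm \<Rightarrow> nat \<Rightarrow> view \<Rightarrow> attack
       \<Rightarrow> real" where
  "attack_utility \<sigma> \<tau> ids \<Lambda> r h A =
     (SUP t. measure_pmf.expectation
        (do { (N, a, st) \<leftarrow> posterior \<sigma> \<tau> ids \<Lambda> r h;
              s \<leftarrow> attack_run \<Lambda> N a A t (attack_start N a A st);
              return_pmf (utility N a (preferred h) (attack_outputs a s)) })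
        (\<lambda>x. x))"

definition equilibrium ::
    "nat pmf \<Rightarrow> topology_prior \<Rightarrow> (nat \<Rightarrow> nat set) \<Rightarrow> algorithm \<Rightarrow> bool" where
  "equilibrium \<sigma> \<tau> ids \<Lambda> \<longleftrightarrow>
     (\<forall>r. \<forall>h \<in> own_view ` set_pmf (honest_play \<sigma> \<tau> ids \<Lambda> r).
        \<forall>A. valid_attack (ports h) A \<longrightarrow>
          attack_utility \<sigma> \<tau> ids \<Lambda> r h A \<le> honest_utility \<sigma> \<tau> ids \<Lambda> r h)"

text \<open>
  The agents' beliefs about the topology are not part of the model, beyond what \<open>\<sigma>\<close> says about the
  size, so the equilibrium condition is required for all such beliefs.  As a belief includes the
  agent's place, this covers all agents.
\<close>

definition orientation_equilibrium :: "nat pmf \<Rightarrow> (nat \<Rightarrow> nat set) \<Rightarrow> algorithm \<Rightarrow> bool" where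
  "orientation_equilibrium \<sigma> ids \<Lambda> \<longleftrightarrow>
     solves_orientation \<sigma> ids \<Lambda> \<and> aborts_on_detection \<sigma> ids \<Lambda> \<and>
     (\<forall>\<tau>. topology_prior \<sigma> \<tau> \<longrightarrow> equilibrium \<sigma> \<tau> ids \<Lambda>)"

end

theory Submission
  imports Defs
begin

text \<open>
  In round 0 every agent sends its id and a fresh random bit over each of its edges; the ids and the
  exclusive or of the two bits determine the direction of the edge, which both ends output in
  round 1.  Messages of round 0 are simultaneous, so whatever a cheater with \<open>k\<close> edges does before
  the start, and whichever agents it pretends to be, each of its \<open>k\<close> real neighbours obtains a
  uniform and independent direction: all of them are the preferred ones with probability at most
  \<open>2\<^sup>-\<^sup>k\<close>, which is exactly the honest probability.  After round 0 the outputs of the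
  neighbours are fixed up to aborting, so that no deviation can help.  As the protocol is local, the
  size of the network plays no role.
\<close>

section \<open>Bounds on the probability of an event under a monadic bind\<close>

lemma prob_bind_le:
  assumes "\<And>x. x \<in> set_pmf p \<Longrightarrow> measure_pmf.prob (k x) X \<le> c" and "0 \<le> c"
  shows "measure_pmf.prob (p \<bind> k) X \<le> c"
proof -
  have "emeasure (bind_pmf p k) X = (\<integral>\<^sup>+x. emeasure (k x) X \<partial>p)" by simp
  also have "\<dots> \<le> (\<integral>\<^sup>+x. ennreal c \<partial>p)"
    using assms by (intro nn_integral_mono_AE)
      (auto simp: AE_measure_pmf_iff measure_pmf.emeasure_eq_measure ennreal_leI)
  finally show ?thesis
    using assms(2) by (simp add: measure_pmf.emeasure_eq_measure)
qed

text \<open>Outside \<open>E\<close> the second stage reaches \<open>X\<close> with probability 0,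
  inside with at most 1. This charges the success of an arbitrarily long continuation to the coin
  tosses of its first round.\<close>

lemma prob_bind_le_prob:
  assumes "\<And>x y. x \<in> set_pmf p \<Longrightarrow> y \<in> set_pmf (k x) \<Longrightarrow> y \<in> X \<Longrightarrow> x \<in> E"
  shows "measure_pmf.prob (p \<bind> k) X \<le> measure_pmf.prob p E"
proof -
  have "emeasure (bind_pmf p k) X = (\<integral>\<^sup>+x. emeasure (k x) X \<partial>p)" by simp
  also have "\<dots> \<le> (\<integral>\<^sup>+x. indicator E x \<partial>p)"
  proof (intro nn_integral_mono_AE AE_pmfI)
    fix x assume "x \<in> set_pmf p"
    then have "x \<notin> E \<Longrightarrow> measure_pmf.prob (k x) X = 0"
      using assms by (subst measure_pmf_zero_iff) auto
    then show "emeasure (k x) X \<le> indicator E x"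
      by (auto simp: measure_pmf.emeasure_eq_measure split: split_indicator)
  qed
  finally show ?thesis
    by (simp add: measure_pmf.emeasure_eq_measure)
qed

lemma prob_bind_ge:
  assumes "\<And>x. x \<in> set_pmf p \<Longrightarrow> c \<le> measure_pmf.prob (k x) X"
  shows "c \<le> measure_pmf.prob (p \<bind> k) X"
\<comment> \<open>The case split is there because \<open>ennreal\<close> maps negative numbers to
  0.\<close>
proof (cases "0 \<le> c")
  case True
  have "ennreal c = (\<integral>\<^sup>+x. ennreal c \<partial>p)" by simp
  also have "\<dots> \<le> (\<integral>\<^sup>+x. emeasure (k x) X \<partial>p)"
    using assms by (intro nn_integral_mono_AE)
      (auto simp: AE_measure_pmf_iff measure_pmf.emeasure_eq_measure ennreal_leI)
  also have "\<dots> = emeasure (bind_pmf p k) X" by simp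
  finally show ?thesis
    by (simp add: measure_pmf.emeasure_eq_measure del: emeasure_bind_pmf)
next
  case False
  then show ?thesis using measure_nonneg[of "bind_pmf p k" X] by linarith
qed

lemma prob_bind_ge_prob:
  assumes "\<And>x y. x \<in> set_pmf p \<Longrightarrow> x \<in> E \<Longrightarrow> y \<in> set_pmf (k x) \<Longrightarrow> y \<in> X"
  shows "measure_pmf.prob p E \<le> measure_pmf.prob (p \<bind> k) X"
proof -
  have "emeasure p E = (\<integral>\<^sup>+x. indicator E x \<partial>p)" by simp
  also have "\<dots> \<le> (\<integral>\<^sup>+x. emeasure (k x) X \<partial>p)"
  proof (intro nn_integral_mono_AE AE_pmfI)
    fix x assume "x \<in> set_pmf p"
    then have "x \<in> E \<Longrightarrow> measure_pmf.prob (k x) X = 1"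
      using assms by (subst measure_pmf.prob_eq_1) (auto simp: AE_measure_pmf_iff)
    then show "indicator E x \<le> emeasure (k x) X"
      by (auto simp: measure_pmf.emeasure_eq_measure split: split_indicator)
  qed
  also have "\<dots> = emeasure (bind_pmf p k) X" by simp
  finally show ?thesis
    by (simp add: measure_pmf.emeasure_eq_measure del: emeasure_bind_pmf)
qed

text \<open>Utilities are 0 or 1, so this turns expected utilities into probabilities of
  success.\<close>

lemma expectation_binary_pmf:
  fixes M :: "real pmf"
  assumes "set_pmf M \<subseteq> {0, 1}"
  shows "measure_pmf.expectation M (\<lambda>x. x) = measure_pmf.prob M {1}"
  using assms by (subst integral_measure_pmf_real[where A = "{1}"]) (auto simp: measure_pmf_single)

section \<open>Networks and executions\<close>

lemma simple_network_peer:
  assumes "simple_links (half_edges N) (peer N)" "v < net_size N" "p < deg N v"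
    and "peer N (v, p) = (u, q)"
  shows "u < net_size N" "q < deg N u" "u \<noteq> v" "peer N (u, q) = (v, p)"
proof -
  have "(v, p) \<in> half_edges N" using assms(2,3) by (simp add: half_edges_def)
  then have "(u, q) \<in> half_edges N" "peer N (u, q) = (v, p)" "u \<noteq> v"
    using assms(1,4) by (metis simple_links_def, metis simple_links_def, metis fst_conv simple_links_def)
  then show "u < net_size N" "q < deg N u" "u \<noteq> v" "peer N (u, q) = (v, p)"
    by (auto simp: half_edges_def)
qed

text \<open>Directions are relative to the agent, and the two ends of an edge are distinct nodes.
  Hence agreeing on the directed edge means holding different values of type
  \<open>direction\<close>.\<close>

lemma legal_opposite:
  assumes "legal N out" "simple_links (half_edges N) (peer N)"
    and "v < net_size N" "p < deg N v" "peer N (v, p) = (u, q)"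
    and "out v = Some (Orient ds)" "out u = Some (Orient es)"
  shows "ds ! p \<noteq> es ! q"
proof -
  obtain D where D: "\<forall>v<net_size N. out v = Some (Orient (D v)) \<and> length (D v) = deg N v"
      "\<forall>x\<in>half_edges N. declared N D x = declared N D (peer N x)"
    using assms(1) by (auto simp: legal_def)
  note p = simple_network_peer[OF assms(2-5)]
  have "declared N D (v, p) = declared N D (u, q)"
    using D(2) assms(3-5) by (force simp: half_edges_def)
  then have "D v ! p \<noteq> D u ! q"
    using p assms(5) by (auto simp: declared_def split: direction.splits)
  then show ?thesis using D(1) assms(3,6,7) p(1) by auto
qed

lemma legalI:
  assumes "simple_links (half_edges N) (peer N)"
    and "\<And>v. v < net_size N \<Longrightarrow> out v = Some (Orient (D v)) \<and> length (D v) = deg N v"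
    and "\<And>v p u q. v < net_size N \<Longrightarrow> p < deg N v \<Longrightarrow> peer N (v, p) = (u, q) \<Longrightarrow>
           D v ! p \<noteq> D u ! q"
  shows "legal N out"
  unfolding legal_def
proof (intro exI conjI ballI)
  show "\<forall>v<net_size N. out v = Some (Orient (D v)) \<and> length (D v) = deg N v"
    using assms(2) by simp
  fix x assume "x \<in> half_edges N"
  then obtain v p u q where x: "x = (v, p)" "v < net_size N" "p < deg N v" "peer N (v, p) = (u, q)"
    by (cases x, cases "peer N x") (auto simp: half_edges_def)
  then show "declared N D x = declared N D (peer N x)"
    using assms(3)[OF x(2-4)] simple_network_peer[OF assms(1) x(2-4)]
    by (auto simp: declared_def split: direction.splits)
qed

section \<open>The effect of rounds on single views, and the splitting of executions\<close>

definition record_round :: "action \<Rightarrow> message list \<Rightarrow> view \<Rightarrow> view" where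
  "record_round act ms h = h\<lparr>history := history h @ [(act, ms)]\<rparr>"

lemma record_round_simps [simp]:
  "ident (record_round act ms h) = ident h"
  "ports (record_round act ms h) = ports h"
  "preferred (record_round act ms h) = preferred h"
  "history (record_round act ms h) = history h @ [(act, ms)]"
  by (simp_all add: record_round_def)

lemma decided_Nil: "history h = [] \<Longrightarrow> decided h = None"
  by (simp add: decided_def)

lemma decided_record_round:
  "decided (record_round act ms h) =
     (case decided h of None \<Rightarrow> decision act | Some d \<Rightarrow> Some d)"
proof -
  have "(case filter (\<lambda>d. d \<noteq> None) (xs @ [y]) of [] \<Rightarrow> None | d # _ \<Rightarrow> d) =
      (case (case filter (\<lambda>d. d \<noteq> None) xs of [] \<Rightarrow> None | d # _ \<Rightarrow> d) of
         None \<Rightarrow> y | Some d \<Rightarrow> Some d)" for xs :: "result option list" and y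
    by (induction xs) (auto split: option.split)
  then show ?thesis by (simp add: decided_def)
qed

definition received :: "network \<Rightarrow> (nat \<Rightarrow> action) \<Rightarrow> nat \<Rightarrow> message list" where
  "received N act v =
     map (\<lambda>p. case peer N (v, p) of (u, q) \<Rightarrow> message_on (act u) q) [0..<deg N v]"

lemma nth_received:
  "p < deg N v \<Longrightarrow> peer N (v, p) = (u, q) \<Longrightarrow> received N act v ! p = message_on (act u) q"
  by (simp add: received_def)

lemma exchange_apply:
  "v < net_size N \<Longrightarrow> exchange N act st v = record_round (act v) (received N act v) (st v)"
  by (simp add: exchange_def record_round_def received_def)

lemma honest_run_add:
  "honest_run \<Lambda> N (r + t) st = honest_run \<Lambda> N r st \<bind> honest_run \<Lambda> N t"
  by (induction t) (simp_all add: bind_return_pmf' bind_assoc_pmf)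

lemma set_honest_run_1:
  assumes "st' \<in> set_pmf (honest_run \<Lambda> N 1 st)"
  obtains act where "st' = exchange N act st" "\<And>v. v < net_size N \<Longrightarrow> act v \<in> set_pmf (\<Lambda> (st v))"
  using assms by (auto simp: bind_return_pmf set_Pi_pmf PiE_dflt_def)

text \<open>The recursion of \<open>attack_run\<close> peels off the last round, but the coins are
  tossed in the first one.\<close>

lemma attack_run_Suc_left:
  "attack_run \<Lambda> N c A (Suc t) s = attack_round \<Lambda> N c A s \<bind> attack_run \<Lambda> N c A t"
  by (induction t) (simp_all add: bind_return_pmf bind_return_pmf' bind_assoc_pmf)

section \<open>Aborting on detection\<close>

definition possible_start :: "nat pmf \<Rightarrow> (nat \<Rightarrow> nat set) \<Rightarrow> network \<Rightarrow> profile \<Rightarrow> bool" where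
  "possible_start \<sigma> ids N prof \<longleftrightarrow>
     two_connected_network N \<and> net_size N \<in> set_pmf \<sigma> \<and> prof \<in> profiles ids N"

text \<open>The test refers to the views of the unwrapped algorithm, which keeps the definition from
  being circular. That wrapping does not change the set of honest views is shown in
  \<open>honest_views_detecting\<close>.\<close>

definition detecting :: "nat pmf \<Rightarrow> (nat \<Rightarrow> nat set) \<Rightarrow> algorithm \<Rightarrow> algorithm" where
  "detecting \<sigma> ids \<Lambda> h =
     (if decided h = None \<and> h \<notin> honest_views \<sigma> ids \<Lambda>
      then return_pmf \<lparr>sent = [], decision = Some Abort\<rparr> else \<Lambda> h)"

lemma honest_viewsI:
  assumes "possible_start \<sigma> ids N prof" "st \<in> set_pmf (honest_run \<Lambda> N t (initial N prof))"
    and "v < net_size N"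
  shows "st v \<in> honest_views \<sigma> ids \<Lambda>"
  using assms unfolding honest_views_def possible_start_def by blast

text \<open>An honest execution passes through honest views only, so the added abort is never
  triggered. Starting in the middle of an execution is needed for utilities estimated at later
  rounds.\<close>

lemma honest_run_detecting_from:
  assumes "possible_start \<sigma> ids N prof" "st \<in> set_pmf (honest_run \<Lambda> N r (initial N prof))"
  shows "honest_run (detecting \<sigma> ids \<Lambda>) N t st = honest_run \<Lambda> N t st"
proof (induction t)
  case (Suc t)
  have "Pi_pmf {..<net_size N} idle (\<lambda>v. detecting \<sigma> ids \<Lambda> (st' v)) =
      Pi_pmf {..<net_size N} idle (\<lambda>v. \<Lambda> (st' v))"
    if "st' \<in> set_pmf (honest_run \<Lambda> N t st)" for st'
  proof (rule Pi_pmf_cong)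
    fix v assume "v \<in> {..<net_size N}"
    moreover have "st' \<in> set_pmf (honest_run \<Lambda> N (r + t) (initial N prof))"
      using that assms(2) by (auto simp: honest_run_add)
    ultimately show "detecting \<sigma> ids \<Lambda> (st' v) = \<Lambda> (st' v)"
      using honest_viewsI[OF assms(1)] by (auto simp: detecting_def)
  qed auto
  then show ?case by (auto simp: Suc.IH intro!: bind_pmf_cong)
qed simp

lemma honest_run_detecting:
  "possible_start \<sigma> ids N prof \<Longrightarrow>
     honest_run (detecting \<sigma> ids \<Lambda>) N t (initial N prof) = honest_run \<Lambda> N t (initial N prof)"
  by (rule honest_run_detecting_from[where r = 0]) auto

lemma honest_views_detecting:
  "honest_views \<sigma> ids (detecting \<sigma> ids \<Lambda>) = honest_views \<sigma> ids \<Lambda>"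
  using honest_run_detecting[of \<sigma> ids _ _ \<Lambda>]
  unfolding honest_views_def possible_start_def by (intro Collect_cong) metis

lemma aborts_on_detection_detecting: "aborts_on_detection \<sigma> ids (detecting \<sigma> ids \<Lambda>)"
  unfolding aborts_on_detection_def honest_views_detecting by (simp add: detecting_def)

lemma solves_orientation_detecting:
  "solves_orientation \<sigma> ids (detecting \<sigma> ids \<Lambda>) \<longleftrightarrow> solves_orientation \<sigma> ids \<Lambda>"
  unfolding solves_orientation_def
  using honest_run_detecting[of \<sigma> ids _ _ \<Lambda>] by (simp add: possible_start_def)

section \<open>Tossing a coin for every edge\<close>

text \<open>
  A message \<open>[i, b]\<close> carries an id and a bit.  The parity of the sum of the two bits decides
  whether the edge points towards the larger id, so that flipping either bit reverses the edge.
  The test is by parity because a cheater may send any number in place of the bit.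
\<close>

definition direction_of :: "message \<Rightarrow> message \<Rightarrow> direction" where
  "direction_of m m' =
     (if (hd m < hd m') = even (last m + last m') then Outward else Inward)"

definition toss :: algorithm where
  "toss h = map_pmf (\<lambda>b. \<lparr>sent = map (\<lambda>p. [ident h, of_bool (b p)]) [0..<ports h], decision = None\<rparr>)
     (Pi_pmf {..<ports h} False (\<lambda>_. bernoulli_pmf (1 / 2)))"

text \<open>Only the first entry of the history is read, so the value is fixed once round 0 is over;
  it is meaningful for nonempty histories.\<close>

definition chosen :: "view \<Rightarrow> direction list" where
  "chosen h =
     (case hd (history h) of (act, ms) \<Rightarrow>
        map (\<lambda>p. direction_of (message_on act p) (ms ! p)) [0..<ports h])"

definition coin_tossing :: algorithm where
  "coin_tossing h =
     (case history h of
        [] \<Rightarrow> toss h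
      | [_] \<Rightarrow> return_pmf \<lparr>sent = [], decision = Some (Orient (chosen h))\<rparr>
      | _ \<Rightarrow> return_pmf idle)"

lemma length_chosen [simp]: "length (chosen h) = ports h"
  by (simp add: chosen_def split: prod.split)

lemma chosen_record_round [simp]: "history h \<noteq> [] \<Longrightarrow> chosen (record_round act ms h) = chosen h"
  by (simp add: chosen_def)

lemma nth_chosen_first_round:
  "history h = [] \<Longrightarrow> p < ports h \<Longrightarrow>
     chosen (record_round act ms h) ! p = direction_of (message_on act p) (ms ! p)"
  by (simp add: chosen_def)

lemma opposite_of_opposite:
  fixes d d' e :: direction
  shows "e \<noteq> d' \<Longrightarrow> d \<noteq> e \<Longrightarrow> d = d'"
  by (cases d; cases d'; cases e) auto

text \<open>The parity of the sum is symmetric in the two messages, while the comparison of distinct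
  ids is antisymmetric.\<close>

lemma direction_of_swap:
  "hd m \<noteq> hd m' \<Longrightarrow> direction_of m m' \<noteq> direction_of m' m"
  by (auto simp: direction_of_def add.commute)

lemma set_toss:
  assumes "act \<in> set_pmf (toss h)"
  shows "decision act = None" "p < ports h \<Longrightarrow> hd (message_on act p) = ident h"
  using assms by (auto simp: toss_def message_on_def)

text \<open>Flipping the own bit flips the parity, so exactly one of its two values avoids
  \<open>d\<close>, whatever the other message \<open>m\<close> contains, be it an equal id or a
  number that is not a bit.\<close>

lemma toss_fair:
  assumes "q < ports h"
  shows "measure_pmf.prob (toss h) {act. direction_of (message_on act q) m \<noteq> d} = 1 / 2"
proof -
  let ?coins = "Pi_pmf {..<ports h} False (\<lambda>_. bernoulli_pmf (1 / 2))"
  define B where "B = {b. direction_of [ident h, of_bool b] m \<noteq> d}"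
  have "card B = 1"
  proof -
    have "B = {True} \<or> B = {False}"
      by (cases d) (auto simp: B_def direction_of_def set_eq_iff split: if_splits; metis)+
    then show ?thesis by auto
  qed
  then obtain b where b: "B = {b}" by (auto simp: card_1_singleton_iff)
  have "measure_pmf.prob (toss h) {act. direction_of (message_on act q) m \<noteq> d} =
      measure_pmf.prob ?coins {f. f q \<in> B}"
    unfolding toss_def measure_map_pmf using assms
    by (intro arg_cong[where f = "measure_pmf.prob ?coins"]) (auto simp: B_def message_on_def)
  also have "\<dots> = measure_pmf.prob (map_pmf (\<lambda>f. f q) ?coins) B"
    by (simp add: measure_map_pmf vimage_def)
  also have "\<dots> = pmf (bernoulli_pmf (1 / 2)) b"
    using assms by (simp add: Pi_pmf_component b measure_pmf_single)
  also have "\<dots> = 1 / 2" by (cases b) auto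
  finally show ?thesis .
qed

text \<open>
  There are no parallel edges, so different edges of \<open>c\<close> are governed by coins of different
  neighbours, which are independent.
\<close>

lemma neighbour_tosses_fair:
  assumes "simple_links (half_edges N) (peer N)" "c < net_size N"
    and "\<And>v. v < net_size N \<Longrightarrow> ports (st v) = deg N v"
  shows "measure_pmf.prob (Pi_pmf ({..<net_size N} - {c}) idle (\<lambda>v. toss (st v)))
           {act. \<forall>p<deg N c. \<forall>u q. peer N (c, p) = (u, q) \<longrightarrow>
              direction_of (message_on (act u) q) (m p) \<noteq> d p} = (1 / 2) ^ deg N c"
proof -
  \<comment> \<open>\<open>B u\<close> collects the demands on \<open>u\<close> alone. It amounts to
    a single demand if \<open>u\<close> is in the set \<open>U\<close> of neighbours of
    \<open>c\<close>, and to none otherwise, whence the factors 1/2 and 1 below.\<close>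
  define B where "B u = {act. \<forall>p<deg N c. \<forall>q. peer N (c, p) = (u, q) \<longrightarrow>
      direction_of (message_on act q) (m p) \<noteq> d p}" for u
  define U where "U = (\<lambda>p. fst (peer N (c, p))) ` {..<deg N c}"
  have peer: "peer N (c, p) = (u, q) \<Longrightarrow> p < deg N c \<Longrightarrow>
      u < net_size N \<and> q < deg N u \<and> u \<noteq> c" for p u q
    using simple_network_peer[OF assms(1,2)] by blast
  have inj: "inj_on (\<lambda>p. fst (peer N (c, p))) {..<deg N c}"
  proof (rule inj_onI)
    fix p p' assume "p \<in> {..<deg N c}" "p' \<in> {..<deg N c}"
      "fst (peer N (c, p)) = fst (peer N (c, p'))"
    then have "(c, p) = (c, p')"
      using assms(1,2) inj_onD[of "\<lambda>x. (fst x, fst (peer N x))" "half_edges N" "(c, p)" "(c, p')"]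
      by (auto simp: simple_links_def half_edges_def)
    then show "p = p'" by simp
  qed
  have U: "U \<subseteq> {..<net_size N} - {c}"
  proof
    fix u assume "u \<in> U"
    then obtain p where "p < deg N c" "u = fst (peer N (c, p))" by (auto simp: U_def)
    then show "u \<in> {..<net_size N} - {c}"
      using peer[of p u "snd (peer N (c, p))"] by simp
  qed
  have half: "measure_pmf.prob (toss (st u)) (B u) = (if u \<in> U then 1 / 2 else 1)"
    if "u \<in> {..<net_size N} - {c}" for u
  proof (cases "u \<in> U")
    case True
    then obtain p q where p: "p < deg N c" "peer N (c, p) = (u, q)"
      by (auto simp: U_def) (metis prod.collapse)
    have "p' < deg N c \<and> peer N (c, p') = (u, q') \<longleftrightarrow> p' = p \<and> q' = q" for p' q'
      using p inj_onD[OF inj, of p' p] by auto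
    then have "B u = {act. direction_of (message_on act q) (m p) \<noteq> d p}"
      unfolding B_def by (metis (lifting))
    then show ?thesis
      using True p peer[OF p(2,1)] assms(3) by (simp add: toss_fair)
  next
    case False
    then have "B u = UNIV" by (force simp: B_def U_def)
    then show ?thesis using False by simp
  qed
  \<comment> \<open>The event is a product of events at single nodes, so its probability under the
    independent tosses factorises.\<close>
  have "{act. \<forall>p<deg N c. \<forall>u q. peer N (c, p) = (u, q) \<longrightarrow>
      direction_of (message_on (act u) q) (m p) \<noteq> d p} = Pi ({..<net_size N} - {c}) B"
    using peer by (fastforce simp: B_def)
  then have "measure_pmf.prob (Pi_pmf ({..<net_size N} - {c}) idle (\<lambda>v. toss (st v)))
      {act. \<forall>p<deg N c. \<forall>u q. peer N (c, p) = (u, q) \<longrightarrow>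
         direction_of (message_on (act u) q) (m p) \<noteq> d p} =
      (\<Prod>u\<in>{..<net_size N} - {c}. measure_pmf.prob (toss (st u)) (B u))"
    by (simp add: measure_Pi_pmf_Pi)
  also have "\<dots> = (\<Prod>u\<in>{..<net_size N} - {c}. if u \<in> U then 1 / 2 else 1)"
    using half by (rule prod.cong[OF refl])
  also have "\<dots> = (1 / 2) ^ card U"
    using U by (simp add: prod.If_cases Int_absorb1)
  also have "card U = deg N c" by (simp add: U_def card_image[OF inj])
  finally show ?thesis .
qed

section \<open>Honest executions of the coin tossing\<close>

lemma initial_simps [simp]:
  "ports (initial N prof v) = deg N v"
  "ident (initial N prof v) = fst (prof v)"
  "preferred (initial N prof v) = snd (prof v)"
  "history (initial N prof v) = []"
  by (simp_all add: initial_def)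

text \<open>The invariant of honest executions from the end of round 0 on. Outputs are made by the
  step of round 1, so a history of length 1 still goes with no output.\<close>

definition settled :: "network \<Rightarrow> (nat \<Rightarrow> view) \<Rightarrow> bool" where
  "settled N st \<longleftrightarrow>
     (\<forall>v<net_size N. ports (st v) = deg N v \<and> history (st v) \<noteq> [] \<and>
        decided (st v) = (if length (history (st v)) = 1 then None else Some (Orient (chosen (st v))))) \<and>
     (\<forall>v p u q. v < net_size N \<longrightarrow> p < deg N v \<longrightarrow> peer N (v, p) = (u, q) \<longrightarrow>
        chosen (st v) ! p \<noteq> chosen (st u) ! q)"

text \<open>Honest messages begin with the id of the sender and ids are distinct, so
  \<open>direction_of_swap\<close> applies to every edge.\<close>

lemma settled_first_round:
  assumes "possible_start \<sigma> ids N prof"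
    and "\<And>v. v < net_size N \<Longrightarrow> act v \<in> set_pmf (toss (initial N prof v))"
  shows "settled N (exchange N act (initial N prof))"
proof -
  have simple: "simple_links (half_edges N) (peer N)"
    and inj: "inj_on (\<lambda>v. fst (prof v)) {..<net_size N}"
    using assms(1) by (auto simp: possible_start_def two_connected_network_def profiles_def)
  have "chosen (exchange N act (initial N prof) v) ! p \<noteq> chosen (exchange N act (initial N prof) u) ! q"
    if v: "v < net_size N" "p < deg N v" "peer N (v, p) = (u, q)" for v p u q
  proof -
    note u = simple_network_peer[OF simple v]
    have "hd (message_on (act v) p) \<noteq> hd (message_on (act u) q)"
      using set_toss(2)[OF assms(2)] v u inj_onD[OF inj, of u v] by auto
    then show ?thesis
      using v u direction_of_swap
      by (simp add: exchange_apply nth_chosen_first_round nth_received)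
  qed
  then show ?thesis
    using set_toss(1)[OF assms(2)]
    by (simp add: settled_def exchange_apply decided_record_round decided_Nil)
qed

text \<open>Later rounds leave \<open>chosen\<close> untouched. The second conclusion shows that a
  single further round brings all outputs, both right after round 0 and later.\<close>

lemma settled_step:
  assumes "settled N st" "st' \<in> set_pmf (honest_run coin_tossing N 1 st)"
    and "simple_links (half_edges N) (peer N)"
  shows "settled N st'"
    and "v < net_size N \<Longrightarrow> chosen (st' v) = chosen (st v) \<and> preferred (st' v) = preferred (st v) \<and>
           decided (st' v) = Some (Orient (chosen (st v)))"
proof -
  obtain act where st': "st' = exchange N act st"
    and act: "\<And>v. v < net_size N \<Longrightarrow> act v \<in> set_pmf (coin_tossing (st v))"
    using set_honest_run_1[OF assms(2)] by blast
  have chosen: "chosen (st' v) = chosen (st v)" "preferred (st' v) = preferred (st v)"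
      "ports (st' v) = ports (st v)" "length (history (st' v)) = Suc (length (history (st v)))"
    if "v < net_size N" for v
    using that assms(1) by (simp_all add: st' exchange_apply settled_def)
  have decided: "decided (st' v) = Some (Orient (chosen (st v)))" if "v < net_size N" for v
  proof (cases "history (st v)")
    case Nil
    then show ?thesis using assms(1) that by (simp add: settled_def)
  next
    case (Cons x xs)
    show ?thesis
    proof (cases xs)
      case Nil
      then have "decision (act v) = Some (Orient (chosen (st v)))"
        using act[OF that] Cons by (simp add: coin_tossing_def)
      then show ?thesis
        using assms(1) that Cons Nil
        by (simp add: st' exchange_apply decided_record_round settled_def)
    next
      case (Cons y ys)
      then show ?thesis
        using assms(1) that \<open>history (st v) = x # xs\<close>
        by (simp add: st' exchange_apply decided_record_round settled_def)
    qed
  qed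
  show "settled N st'"
    unfolding settled_def
  proof (intro conjI allI impI)
    fix v assume v: "v < net_size N"
    show "ports (st' v) = deg N v" using v chosen assms(1) by (simp add: settled_def)
    show "history (st' v) \<noteq> []" using chosen(4)[OF v] by auto
    show "decided (st' v) =
        (if length (history (st' v)) = 1 then None else Some (Orient (chosen (st' v))))"
      using v chosen decided assms(1) by (simp add: settled_def)
    fix p u q assume "p < deg N v" "peer N (v, p) = (u, q)"
    then show "chosen (st' v) ! p \<noteq> chosen (st' u) ! q"
      using v chosen(1) assms(1) simple_network_peer(1)[OF assms(3) v] by (simp add: settled_def)
  qed
  show "v < net_size N \<Longrightarrow> chosen (st' v) = chosen (st v) \<and> preferred (st' v) = preferred (st v) \<and>
      decided (st' v) = Some (Orient (chosen (st v)))"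
    using chosen decided by simp
qed

lemma legal_if_all_chosen:
  assumes "settled N st" "simple_links (half_edges N) (peer N)"
    and "\<And>v. v < net_size N \<Longrightarrow> decided (st v) = Some (Orient (chosen (st v)))"
  shows "legal N (\<lambda>v. decided (st v))"
  using assms by (intro legalI[where D = "\<lambda>v. chosen (st v)"]) (auto simp: settled_def)

lemma settled_honest_run:
  assumes "possible_start \<sigma> ids N prof"
    and "st \<in> set_pmf (honest_run coin_tossing N (Suc r) (initial N prof))"
  shows "settled N st"
  using assms(2)
proof (induction r arbitrary: st)
  case 0
  obtain act where "st = exchange N act (initial N prof)"
    "\<And>v. v < net_size N \<Longrightarrow> act v \<in> set_pmf (toss (initial N prof v))"
    using 0 by (auto elim!: set_honest_run_1[unfolded One_nat_def] simp: coin_tossing_def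
        simp del: honest_run.simps)
  then show ?case using settled_first_round[OF assms(1)] by simp
next
  case (Suc r)
  have "st \<in> set_pmf (honest_run coin_tossing N (Suc r + 1) (initial N prof))"
    using Suc.prems by simp
  then obtain st' where "st' \<in> set_pmf (honest_run coin_tossing N (Suc r) (initial N prof))"
    "st \<in> set_pmf (honest_run coin_tossing N 1 st')"
    unfolding honest_run_add by auto
  then show ?case
    using assms(1)
    by (intro settled_step(1)[OF Suc.IH]) (auto simp: possible_start_def two_connected_network_def)
qed

text \<open>An agent that prefers what the coins have given it is certain of utility 1.\<close>

lemma utility_after_step:
  assumes "settled N st" "st' \<in> set_pmf (honest_run coin_tossing N 1 st)"
    and "simple_links (half_edges N) (peer N)" "a < net_size N"
  shows "utility N a (chosen (st a)) (\<lambda>v. decided (st' v)) = 1"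
  using settled_step[OF assms(1-3)] legal_if_all_chosen[of N st'] assms(3,4)
  by (simp add: utility_def)

lemma solves_orientation_coin_tossing: "solves_orientation \<sigma> ids coin_tossing"
  unfolding solves_orientation_def
proof (intro allI impI)
  fix N prof
  assume "two_connected_network N \<and> net_size N \<in> set_pmf \<sigma> \<and> prof \<in> profiles ids N"
  then have start: "possible_start \<sigma> ids N prof" and simple: "simple_links (half_edges N) (peer N)"
    by (auto simp: possible_start_def two_connected_network_def)
  let ?P = "\<lambda>t. measure_pmf.prob (honest_run coin_tossing N t (initial N prof))
              {st. legal N (\<lambda>v. decided (st v))}"
  have "legal N (\<lambda>v. decided (st v))"
    if "st \<in> set_pmf (honest_run coin_tossing N (Suc 0 + 1) (initial N prof))" for st
  proof -
    obtain st' where st': "st' \<in> set_pmf (honest_run coin_tossing N (Suc 0) (initial N prof))"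
      "st \<in> set_pmf (honest_run coin_tossing N 1 st')"
      using \<open>st \<in> _\<close> unfolding honest_run_add by auto
    note settled = settled_honest_run[OF start st'(1)]
    show ?thesis
      using settled_step[OF settled st'(2) simple] simple by (intro legal_if_all_chosen) auto
  qed
  \<comment> \<open>One round for the coins and one for the outputs: the supremum is attained after
    two rounds.\<close>
  then have "?P (Suc 0 + 1) = 1"
    by (subst measure_pmf.prob_eq_1) (auto simp: AE_measure_pmf_iff simp del: honest_run.simps)
  then show "(SUP t. ?P t) = 1"
    by (intro antisym cSUP_least cSUP_upper2[where x = "Suc 0 + 1"] bdd_aboveI[of _ 1]) auto
qed

text \<open>The honest side of the comparison. Whatever bits \<open>a\<close> tosses itself, the
  bits of its neighbours alone produce \<open>ds\<close> with the stated probability.\<close>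

lemma first_round_all_chosen:
  assumes "possible_start \<sigma> ids N prof" "a < net_size N" "length ds = deg N a"
  shows "(1 / 2) ^ deg N a \<le>
           measure_pmf.prob (honest_run coin_tossing N 1 (initial N prof)) {st. chosen (st a) = ds}"
proof -
  have simple: "simple_links (half_edges N) (peer N)"
    using assms(1) by (simp add: possible_start_def two_connected_network_def)
  let ?toss = "\<lambda>v. toss (initial N prof v)"
  let ?others = "Pi_pmf ({..<net_size N} - {a}) idle ?toss"
  let ?next = "\<lambda>act. exchange N act (initial N prof)"
  have "honest_run coin_tossing N 1 (initial N prof) =
      Pi_pmf (insert a ({..<net_size N} - {a})) idle ?toss \<bind> (\<lambda>act. return_pmf (?next act))"
    using assms(2) by (simp add: bind_return_pmf coin_tossing_def insert_absorb)
  \<comment> \<open>The toss \<open>y\<close> of \<open>a\<close> is drawn first, so that it can be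
    held fixed while the others toss.\<close>
  also have "\<dots> = ?toss a \<bind> (\<lambda>y. ?others \<bind> (\<lambda>act. return_pmf (?next (act(a := y)))))"
    by (subst Pi_pmf_insert') (simp_all add: bind_assoc_pmf bind_return_pmf)
  finally have run: "honest_run coin_tossing N 1 (initial N prof) = \<dots>" .
  show ?thesis
    unfolding run
  proof (rule prob_bind_ge)
    fix y assume y: "y \<in> set_pmf (?toss a)"
    \<comment> \<open>The event is phrased at the far ends of the edges, which must hold the
      opposite of \<open>ds\<close>; in this form \<open>neighbour_tosses_fair\<close>
      applies.\<close>
    let ?E = "{act. \<forall>p<deg N a. \<forall>u q. peer N (a, p) = (u, q) \<longrightarrow>
        direction_of (message_on (act u) q) (message_on y p) \<noteq> ds ! p}"
    have "chosen (?next (act(a := y)) a) = ds" if "act \<in> set_pmf ?others" "act \<in> ?E" for act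
    proof (rule nth_equalityI)
      have "(act(a := y)) v \<in> set_pmf (?toss v)" if "v < net_size N" for v
        using that y \<open>act \<in> set_pmf ?others\<close> by (auto simp: set_Pi_pmf PiE_dflt_def)
      then have settled: "settled N (?next (act(a := y)))"
        by (rule settled_first_round[OF assms(1)])
      show len: "length (chosen (?next (act(a := y)) a)) = length ds"
        using assms(2,3) by (simp add: exchange_apply)
      fix p assume "p < length (chosen (?next (act(a := y)) a))"
      then have p: "p < deg N a" using assms(3) len by simp
      obtain u q where u: "peer N (a, p) = (u, q)" by fastforce
      note u' = simple_network_peer[OF simple assms(2) p u]
      have "chosen (?next (act(a := y)) u) ! q \<noteq> ds ! p"
        using that(2) p u u' by (simp add: exchange_apply nth_chosen_first_round nth_received)
      moreover have "chosen (?next (act(a := y)) a) ! p \<noteq> chosen (?next (act(a := y)) u) ! q"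
        using settled assms(2) p u by (simp add: settled_def)
      ultimately show "chosen (?next (act(a := y)) a) ! p = ds ! p"
        by (blast intro: opposite_of_opposite)
    qed
    then have "measure_pmf.prob ?others ?E \<le>
        measure_pmf.prob (?others \<bind> (\<lambda>act. return_pmf (?next (act(a := y))))) {st. chosen (st a) = ds}"
      by (intro prob_bind_ge_prob) auto
    then show "(1 / 2) ^ deg N a \<le>
        measure_pmf.prob (?others \<bind> (\<lambda>act. return_pmf (?next (act(a := y))))) {st. chosen (st a) = ds}"
      by (simp add: neighbour_tosses_fair[OF simple assms(2)])
  qed
qed

section \<open>Attacks on the coin tossing\<close>

text \<open>What remains of \<open>settled\<close> for a real agent facing a cheater: it may abort
  or stay silent, but has no other orientation to output.\<close>

definition bound_to_chosen :: "view \<Rightarrow> bool" where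
  "bound_to_chosen h \<longleftrightarrow>
     history h \<noteq> [] \<and> decided h \<in> {None, Some Abort, Some (Orient (chosen h))}"

lemma bound_to_chosen_step:
  assumes "bound_to_chosen h" "act \<in> set_pmf (detecting \<sigma> ids coin_tossing h)"
  shows "bound_to_chosen (record_round act ms h)"
  using assms
  by (auto simp: bound_to_chosen_def decided_record_round detecting_def coin_tossing_def idle_def
      split: if_splits list.splits)

definition attack_action ::
    "network \<Rightarrow> nat \<Rightarrow> (nat \<Rightarrow> action) \<Rightarrow> (nat \<Rightarrow> action) \<Rightarrow> nat \<Rightarrow> action" where
  "attack_action N c img hon = (\<lambda>v. if is_imaginary N c v then img (index_of N c v) else hon v)"

text \<open>For the first claim at least one imaginary agent is needed: otherwise the size
  \<open>n + d - 1\<close> would fall below \<open>n\<close> and cut off the last real node.\<close>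

lemma enlarge_real:
  assumes "v < net_size N" "v \<noteq> c" "imaginary A \<noteq> []"
  shows "v < net_size (enlarge N c A)" "deg (enlarge N c A) v = deg N v" "\<not> is_imaginary N c v"
  using assms by (auto simp: enlarge_def is_imaginary_def neq_Nil_conv)

text \<open>Each step of \<open>v\<close> is one of the algorithm, and \<open>chosen\<close> reads
  round 0 only, so no behaviour of \<open>control\<close> affects either of them any more.\<close>

lemma bound_to_chosen_attack_run:
  assumes "s' \<in> set_pmf (attack_run (detecting \<sigma> ids coin_tossing) N c A t s)"
    and "imaginary A \<noteq> []" "v < net_size N" "v \<noteq> c" "bound_to_chosen (fst s v)"
  shows "bound_to_chosen (fst s' v) \<and> chosen (fst s' v) = chosen (fst s v)"
  using assms(1)
proof (induction t arbitrary: s')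
  case (Suc t)
  then obtain s1 where s1: "s1 \<in> set_pmf (attack_run (detecting \<sigma> ids coin_tossing) N c A t s)"
    and s': "s' \<in> set_pmf (attack_round (detecting \<sigma> ids coin_tossing) N c A s1)"
    by auto
  obtain img hon where fst: "fst s' = exchange (enlarge N c A) (attack_action N c img hon) (fst s1)"
    and hon: "hon v \<in> set_pmf (detecting \<sigma> ids coin_tossing (fst s1 v))"
    using s' assms(3,4)
    by (auto simp: attack_round_def attack_action_def set_Pi_pmf PiE_dflt_def)
  have "fst s' v = record_round (hon v) (received (enlarge N c A) (attack_action N c img hon) v) (fst s1 v)"
    using enlarge_real[OF assms(3,4,2)] by (simp add: fst exchange_apply attack_action_def)
  moreover have b: "bound_to_chosen (fst s1 v)" using Suc.IH[OF s1] by simp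
  moreover have "history (fst s1 v) \<noteq> []" using b by (simp add: bound_to_chosen_def)
  ultimately show ?case
    using Suc.IH[OF s1] bound_to_chosen_step[OF b hon] by simp
qed (use assms in simp)

text \<open>Legality rules out \<open>None\<close> and \<open>Abort\<close> at every real neighbour,
  so each of them must have output the direction it already held in \<open>s0\<close>. Success is
  thereby reduced to a condition on \<open>s0\<close>.\<close>

lemma attack_success:
  assumes "s \<in> set_pmf (attack_run (detecting \<sigma> ids coin_tossing) N c A t s0)"
    and "imaginary A \<noteq> []" "simple_links (half_edges N) (peer N)"
    and "c < net_size N" "\<And>v. v < net_size N \<Longrightarrow> v \<noteq> c \<Longrightarrow> bound_to_chosen (fst s0 v)"
    and "utility N c ds (attack_outputs c s) = 1"
  shows "length ds = deg N c"
    and "p < deg N c \<Longrightarrow> peer N (c, p) = (u, q) \<Longrightarrow> chosen (fst s0 u) ! q \<noteq> ds ! p"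
proof -
  have legal: "legal N (attack_outputs c s)" and ds: "attack_outputs c s c = Some (Orient ds)"
    using assms(6) by (auto simp: utility_def split: if_splits)
  show "length ds = deg N c"
    using legal ds assms(4) by (auto simp: legal_def)
  assume p: "p < deg N c" "peer N (c, p) = (u, q)"
  note u = simple_network_peer[OF assms(3,4) p]
  have "bound_to_chosen (fst s u) \<and> chosen (fst s u) = chosen (fst s0 u)"
    using bound_to_chosen_attack_run[OF assms(1,2)] u assms(5) by blast
  moreover have "\<exists>es. decided (fst s u) = Some (Orient es)"
    using legal u(1,3) by (auto simp: legal_def attack_outputs_def)
  ultimately have "attack_outputs c s u = Some (Orient (chosen (fst s0 u)))"
    using u(3) by (auto simp: bound_to_chosen_def attack_outputs_def)
  then show "chosen (fst s0 u) ! q \<noteq> ds ! p"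
    using legal_opposite[OF legal assms(3,4) p ds] by metis
qed

text \<open>The cheater's side of the comparison. Its messages of round 0 are drawn independently of
  the honest tosses; once they are fixed, \<open>neighbour_tosses_fair\<close> bounds the chance
  that all neighbours hold the directions required by \<open>attack_success\<close>.\<close>

lemma attack_from_start:
  assumes "possible_start \<sigma> ids N prof" "c < net_size N" "imaginary A \<noteq> []"
  shows "measure_pmf.prob
           (attack_run (detecting \<sigma> ids coin_tossing) N c A t (attack_start N c A (initial N prof)))
           {s. utility N c ds (attack_outputs c s) = 1} \<le> (1 / 2) ^ deg N c"
proof (cases t)
  case 0
  then show ?thesis
    by (simp add: attack_start_def attack_outputs_def utility_def decided_Nil)
next
  case (Suc t')
  have simple: "simple_links (half_edges N) (peer N)"
    using assms(1) by (simp add: possible_start_def two_connected_network_def)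
  let ?\<Lambda> = "detecting \<sigma> ids coin_tossing"
  define s0 where "s0 = attack_start N c A (initial N prof)"
  let ?others = "Pi_pmf ({..<net_size N} - {c}) idle (\<lambda>v. toss (initial N prof v))"
  let ?imgs = "control A (map (\<lambda>i. fst s0 (node_of N c i)) [0..<length (imaginary A)])"
  let ?next = "\<lambda>img d hon. (exchange (enlarge N c A) (attack_action N c img hon) (fst s0),
      case snd s0 of None \<Rightarrow> d | Some d' \<Rightarrow> Some d')"
  let ?X = "{s. utility N c ds (attack_outputs c s) = 1}"
  have fst_s0: "fst s0 v = initial N prof v" if "v < net_size N" "v \<noteq> c" for v
    using enlarge_real(3)[OF that assms(3)] by (simp add: s0_def attack_start_def)
  have "?\<Lambda> (initial N prof v) = toss (initial N prof v)" if "v < net_size N" for v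
    using honest_viewsI[OF assms(1) _ that, where t = 0 and \<Lambda> = coin_tossing]
    by (simp add: detecting_def coin_tossing_def)
  then have "Pi_pmf ({..<net_size N} - {c}) idle (\<lambda>v. ?\<Lambda> (fst s0 v)) = ?others"
    using fst_s0 by (intro Pi_pmf_cong) auto
  then have "attack_round ?\<Lambda> N c A s0 =
      ?others \<bind> (\<lambda>hon. ?imgs \<bind> (\<lambda>(img, d). return_pmf (?next img d hon)))"
    by (simp add: attack_round_def attack_action_def)
  \<comment> \<open>The two draws of the round are independent and may be swapped, so the cheater's
    joint step can be fixed first.\<close>
  also have "\<dots> = ?imgs \<bind> (\<lambda>(img, d). ?others \<bind> (\<lambda>hon. return_pmf (?next img d hon)))"
    by (subst bind_commute_pmf) (simp add: case_prod_unfold)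
  finally have run: "attack_run ?\<Lambda> N c A t s0 =
      ?imgs \<bind> (\<lambda>(img, d). ?others \<bind> (\<lambda>hon. attack_run ?\<Lambda> N c A t' (?next img d hon)))"
    by (simp add: Suc attack_run_Suc_left bind_assoc_pmf bind_return_pmf case_prod_unfold
        del: attack_run.simps)
  have "measure_pmf.prob (?others \<bind> (\<lambda>hon. attack_run ?\<Lambda> N c A t' (?next img d hon))) ?X
      \<le> (1 / 2) ^ deg N c" for img d
  proof -
    \<comment> \<open>The message that leaves through the real port \<open>p\<close>, sent by the
      imaginary agent to which \<open>p\<close> is handed. The index is kept in the form in which
      \<open>attack_action\<close> computes it.\<close>
    define m where "m p = (case assign A p of (i, j) \<Rightarrow>
        message_on (img (index_of N c (node_of N c i))) j)" for p
    let ?E = "{act. \<forall>p<deg N c. \<forall>u q. peer N (c, p) = (u, q) \<longrightarrow>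
        direction_of (message_on (act u) q) (m p) \<noteq> ds ! p}"
    have "hon \<in> ?E"
      if hon: "hon \<in> set_pmf ?others" and s: "s \<in> set_pmf (attack_run ?\<Lambda> N c A t' (?next img d hon))"
        "s \<in> ?X" for hon s
    proof -
      let ?s1 = "?next img d hon"
      let ?ms = "received (enlarge N c A) (attack_action N c img hon)"
      have s1: "fst ?s1 v = record_round (hon v) (?ms v) (initial N prof v)"
        if "v < net_size N" "v \<noteq> c" for v
        using enlarge_real[OF that assms(3)] fst_s0[OF that]
        by (simp add: exchange_apply attack_action_def)
      have bound: "bound_to_chosen (fst ?s1 v)" if "v < net_size N" "v \<noteq> c" for v
      proof -
        have "hon v \<in> set_pmf (toss (initial N prof v))"
          using hon that by (auto simp: set_Pi_pmf PiE_dflt_def)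
        then show ?thesis
          unfolding s1[OF that] using set_toss(1)
          by (simp add: bound_to_chosen_def decided_record_round decided_Nil)
      qed
      show ?thesis
      proof (intro CollectI allI impI)
        fix p u q assume p: "p < deg N c" "peer N (c, p) = (u, q)"
        note u = simple_network_peer[OF simple assms(2) p]
        obtain i j where ij: "assign A p = (i, j)" by fastforce
        have "peer (enlarge N c A) (u, q) = (node_of N c i, j)"
          using u enlarge_real(3)[OF u(1,3) assms(3)] ij by (simp add: enlarge_def)
        then have "?ms u ! q = message_on (attack_action N c img hon (node_of N c i)) j"
          using u enlarge_real(2)[OF u(1,3) assms(3)] by (intro nth_received) auto
        also have "\<dots> = m p"
          by (auto simp: m_def ij attack_action_def is_imaginary_def node_of_def)
        finally have "chosen (fst ?s1 u) ! q = direction_of (message_on (hon u) q) (m p)"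
          unfolding s1[OF u(1,3)] using u by (simp add: nth_chosen_first_round)
        then show "direction_of (message_on (hon u) q) (m p) \<noteq> ds ! p"
          using attack_success(2)[OF s(1) assms(3) simple assms(2) bound _ p] s(2) by simp
      qed
    qed
    then have "measure_pmf.prob (?others \<bind> (\<lambda>hon. attack_run ?\<Lambda> N c A t' (?next img d hon))) ?X
        \<le> measure_pmf.prob ?others ?E"
      by (rule prob_bind_le_prob)
    then show ?thesis by (simp add: neighbour_tosses_fair[OF simple assms(2)])
  qed
  then show ?thesis
    unfolding s0_def[symmetric] run by (intro prob_bind_le) (auto simp: case_prod_unfold)
qed

section \<open>Equilibrium\<close>

lemma utility_range: "utility N a ds out \<in> {0, 1}"
  by (simp add: utility_def)

text \<open>With \<open>K\<close> and \<open>out\<close> as parameters, the same argument serves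
  honest and attacked continuations.\<close>

lemma expectation_utility:
  "measure_pmf.expectation
     (do { (N, a, st) \<leftarrow> P; x \<leftarrow> K N a st; return_pmf (utility N a ds (out a x)) }) (\<lambda>x. x) =
   measure_pmf.prob
     (do { (N, a, st) \<leftarrow> P; x \<leftarrow> K N a st; return_pmf (utility N a ds (out a x)) }) {1}"
  using utility_range by (intro expectation_binary_pmf) (auto simp: case_prod_unfold)

lemma expectation_utility_le:
  assumes "\<And>N a st. (N, a, st) \<in> set_pmf P \<Longrightarrow>
      measure_pmf.prob (K N a st) {x. utility N a ds (out a x) = 1} \<le> c" and "0 \<le> c"
  shows "measure_pmf.expectation
     (do { (N, a, st) \<leftarrow> P; x \<leftarrow> K N a st; return_pmf (utility N a ds (out a x)) }) (\<lambda>x. x) \<le> c"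
  unfolding expectation_utility
  using assms
  by (intro prob_bind_le) (auto simp: map_pmf_def[symmetric] measure_map_pmf vimage_def)

lemma expectation_utility_ge:
  assumes "\<And>N a st. (N, a, st) \<in> set_pmf P \<Longrightarrow>
      c \<le> measure_pmf.prob (K N a st) {x. utility N a ds (out a x) = 1}"
  shows "c \<le> measure_pmf.expectation
     (do { (N, a, st) \<leftarrow> P; x \<leftarrow> K N a st; return_pmf (utility N a ds (out a x)) }) (\<lambda>x. x)"
  unfolding expectation_utility
  using assms
  by (intro prob_bind_ge) (auto simp: map_pmf_def[symmetric] measure_map_pmf vimage_def)

text \<open>A bound that holds for each possible network and state survives averaging with any
  weights of the posterior, hence for every prior on the size and every belief about the
  topology.\<close>

lemma attack_utility_le:
  assumes "\<And>t N a st. (N, a, st) \<in> set_pmf (posterior \<sigma> \<tau> ids \<Lambda> r h) \<Longrightarrow>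
      measure_pmf.prob (attack_run \<Lambda> N a A t (attack_start N a A st))
        {s. utility N a (preferred h) (attack_outputs a s) = 1} \<le> c" and "0 \<le> c"
  shows "attack_utility \<sigma> \<tau> ids \<Lambda> r h A \<le> c"
  unfolding attack_utility_def
  using assms by (intro cSUP_least expectation_utility_le[where out = attack_outputs]) auto

text \<open>One number \<open>t\<close> of rounds suffices, as the expectations are bounded by 1 and
  the supremum is at least each of them.\<close>

lemma honest_utility_ge:
  assumes "\<And>N a st. (N, a, st) \<in> set_pmf (posterior \<sigma> \<tau> ids \<Lambda> r h) \<Longrightarrow>
      c \<le> measure_pmf.prob (honest_run \<Lambda> N t st)
        {st'. utility N a (preferred h) (\<lambda>v. decided (st' v)) = 1}"
  shows "c \<le> honest_utility \<sigma> \<tau> ids \<Lambda> r h"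
proof -
  let ?e = "\<lambda>t. measure_pmf.expectation
      (do { (N, a, st) \<leftarrow> posterior \<sigma> \<tau> ids \<Lambda> r h;
            st' \<leftarrow> honest_run \<Lambda> N t st;
            return_pmf (utility N a (preferred h) (\<lambda>v. decided (st' v))) }) (\<lambda>x. x)"
  have "c \<le> ?e t"
    using assms by (intro expectation_utility_ge[where out = "\<lambda>_ x v. decided (x v)"])
  moreover have "?e t \<le> 1" for t
    by (intro expectation_utility_le[where out = "\<lambda>_ x v. decided (x v)"]) auto
  ultimately show ?thesis
    unfolding honest_utility_def by (intro cSUP_upper2[where x = t] bdd_aboveI[of _ 1]) auto
qed

text \<open>Needed for the support of \<open>pmf_of_set\<close> to be \<open>profiles ids N\<close>.
  The profile that shows nonemptiness takes distinct ids and prefers \<open>Outward\<close>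
  everywhere.\<close>

lemma finite_nonempty_profiles:
  assumes "finite (ids (net_size N))" "net_size N \<le> card (ids (net_size N))"
  shows "finite (profiles ids N)" "profiles ids N \<noteq> {}"
proof -
  have "finite {ds :: direction list. length ds = n}" for n
    using finite_lists_length_eq[of "{Outward, Inward}" n]
    by (rule rev_finite_subset) (auto intro: direction.exhaust)
  then have "finite (\<Pi>\<^sub>E v\<in>{..<net_size N}. ids (net_size N) \<times> {ds :: direction list. length ds = deg N v})"
    using assms(1) by (intro finite_PiE finite_cartesian_product) auto
  then show "finite (profiles ids N)" by (simp add: profiles_def)
  obtain f where f: "f ` {..<net_size N} \<subseteq> ids (net_size N)" "inj_on f {..<net_size N}"
    using card_le_inj[of "{..<net_size N}" "ids (net_size N)"] assms by auto
  have "restrict (\<lambda>v. (f v, replicate (deg N v) Outward)) {..<net_size N} \<in> profiles ids N"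
    using f by (auto simp: profiles_def inj_on_def)
  then show "profiles ids N \<noteq> {}" by blast
qed

theorem theorem5p6:
  fixes \<sigma> :: "nat pmf" and ids :: "nat \<Rightarrow> nat set"
  assumes "0 \<notin> set_pmf \<sigma>"
    and "\<And>n. n \<in> set_pmf \<sigma> \<Longrightarrow> finite (ids n) \<and> n \<le> card (ids n)"
  shows "\<exists>\<Lambda>. orientation_equilibrium \<sigma> ids \<Lambda>"
proof
  let ?\<Lambda> = "detecting \<sigma> ids coin_tossing"
  have "equilibrium \<sigma> \<tau> ids ?\<Lambda>" if \<tau>: "topology_prior \<sigma> \<tau>" for \<tau>
    unfolding equilibrium_def
  proof (intro allI ballI impI)
    fix r h A
    assume h: "h \<in> own_view ` set_pmf (honest_play \<sigma> \<tau> ids ?\<Lambda> r)"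
      and "valid_attack (ports h) A"
    then have A: "imaginary A \<noteq> []" by (simp add: valid_attack_def)
    \<comment> \<open>Everything the proof uses about the posterior: its support consists of states
      of honest executions of the unwrapped protocol that show \<open>h\<close> to the
      agent.\<close>
    have posterior: "\<exists>prof. possible_start \<sigma> ids N prof \<and> a < net_size N \<and> st a = h \<and>
        st \<in> set_pmf (honest_run coin_tossing N r (initial N prof))"
      if "(N, a, st) \<in> set_pmf (posterior \<sigma> \<tau> ids ?\<Lambda> r h)" for N a st
    proof -
      \<comment> \<open>Conditioning needs an event of positive probability; \<open>h\<close> does
        occur in honest play.\<close>
      have "set_pmf (honest_play \<sigma> \<tau> ids ?\<Lambda> r) \<inter> {s. own_view s = h} \<noteq> {}" using h by auto
      then have "(N, a, st) \<in> set_pmf (honest_play \<sigma> \<tau> ids ?\<Lambda> r)" and view: "st a = h"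
        using that by (auto simp: posterior_def set_cond_pmf own_view_def)
      then obtain n prof where n: "n \<in> set_pmf \<sigma>" "(N, a) \<in> set_pmf (\<tau> n)"
        and prof: "prof \<in> set_pmf (pmf_of_set (profiles ids N))"
        and st: "st \<in> set_pmf (honest_run ?\<Lambda> N r (initial N prof))"
        by (auto simp: honest_play_def)
      have N: "two_connected_network N" "net_size N = n" "a < n"
        using \<tau> n by (auto simp: topology_prior_def)
      then have "possible_start \<sigma> ids N prof"
        using n(1) prof finite_nonempty_profiles[of ids N] assms(2)[OF n(1)]
        by (simp add: possible_start_def)
      then show ?thesis
        using st N view by (auto simp: honest_run_detecting)
    qed
    show "attack_utility \<sigma> \<tau> ids ?\<Lambda> r h A \<le> honest_utility \<sigma> \<tau> ids ?\<Lambda> r h"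
    proof (cases r)
      case 0
      \<comment> \<open>Before round 0 both utilities are compared with the probability that
        \<open>ports h\<close> fair coins all fall as preferred.\<close>
      have "attack_utility \<sigma> \<tau> ids ?\<Lambda> r h A \<le> (1 / 2) ^ ports h"
      proof (rule attack_utility_le)
        fix t N a st assume "(N, a, st) \<in> set_pmf (posterior \<sigma> \<tau> ids ?\<Lambda> r h)"
        then show "measure_pmf.prob (attack_run ?\<Lambda> N a A t (attack_start N a A st))
            {s. utility N a (preferred h) (attack_outputs a s) = 1} \<le> (1 / 2) ^ ports h"
          using posterior 0 attack_from_start[OF _ _ A] by fastforce
      qed simp
      also have "\<dots> \<le> honest_utility \<sigma> \<tau> ids ?\<Lambda> r h"
      proof (rule honest_utility_ge)
        fix N a st assume "(N, a, st) \<in> set_pmf (posterior \<sigma> \<tau> ids ?\<Lambda> r h)"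
        then obtain prof where start: "possible_start \<sigma> ids N prof" and a: "a < net_size N"
          and st: "st = initial N prof" and h: "h = initial N prof a"
          using posterior 0 by fastforce
        have simple: "simple_links (half_edges N) (peer N)"
          and len: "length (snd (prof a)) = deg N a"
          using start a by (auto simp: possible_start_def two_connected_network_def profiles_def
              PiE_iff mem_Times_iff)
        have "(1 / 2) ^ ports h \<le> measure_pmf.prob (honest_run coin_tossing N 1 st)
            {st1. chosen (st1 a) = preferred h}"
          using first_round_all_chosen[OF start a len] by (simp add: h st del: honest_run.simps)
        also have "\<dots> \<le> measure_pmf.prob (honest_run coin_tossing N (1 + 1) st)
            {st'. utility N a (preferred h) (\<lambda>v. decided (st' v)) = 1}"
          unfolding honest_run_add
        proof (rule prob_bind_ge_prob)
          fix st1 st2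
          assume st1: "st1 \<in> set_pmf (honest_run coin_tossing N 1 st)"
            and "st1 \<in> {st1. chosen (st1 a) = preferred h}"
            and st2: "st2 \<in> set_pmf (honest_run coin_tossing N 1 st1)"
          moreover have "settled N st1"
            using settled_honest_run[OF start, of st1 0] st1 st by (simp del: honest_run.simps)
          ultimately show "st2 \<in> {st'. utility N a (preferred h) (\<lambda>v. decided (st' v)) = 1}"
            using utility_after_step[OF _ st2 simple a] by simp
        qed
        finally show "(1 / 2) ^ ports h \<le> measure_pmf.prob (honest_run ?\<Lambda> N (1 + 1) st)
            {st'. utility N a (preferred h) (\<lambda>v. decided (st' v)) = 1}"
          using honest_run_detecting[OF start] by (simp add: st del: honest_run.simps)
      qed
      finally show ?thesis .
    next
      case (Suc r')
      \<comment> \<open>From round 1 on, the view \<open>h\<close> already shows how the coins fell: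
        honesty secures utility 1 if they fell as preferred, and otherwise no attack can
        succeed.\<close>
      let ?c = "if chosen h = preferred h then 1 else 0 :: real"
      have "attack_utility \<sigma> \<tau> ids ?\<Lambda> r h A \<le> ?c"
      proof (rule attack_utility_le)
        fix t N a st assume "(N, a, st) \<in> set_pmf (posterior \<sigma> \<tau> ids ?\<Lambda> r h)"
        then obtain prof where start: "possible_start \<sigma> ids N prof" and a: "a < net_size N"
          and h: "st a = h" and st: "st \<in> set_pmf (honest_run coin_tossing N (Suc r') (initial N prof))"
          using posterior Suc by blast
        have simple: "simple_links (half_edges N) (peer N)"
          using start by (auto simp: possible_start_def two_connected_network_def)
        note settled = settled_honest_run[OF start st]
        let ?s0 = "attack_start N a A st"
        have s0: "fst ?s0 v = st v" if "v < net_size N" "v \<noteq> a" for v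
          using enlarge_real(3)[OF that A] by (simp add: attack_start_def)
        have bound: "bound_to_chosen (fst ?s0 v)" if "v < net_size N" "v \<noteq> a" for v
          using settled that by (simp add: s0 settled_def bound_to_chosen_def)
        \<comment> \<open>Success forces each neighbour to hold the opposite of the preferred
          direction, and it also holds the opposite of \<open>chosen h\<close>; as there are only
          two directions, these coincide.\<close>
        have "chosen h = preferred h"
          if s: "s \<in> set_pmf (attack_run ?\<Lambda> N a A t ?s0)"
            "utility N a (preferred h) (attack_outputs a s) = 1" for s
        proof (rule nth_equalityI)
          note success = attack_success[OF s(1) A simple a bound s(2)]
          have ports: "ports h = deg N a" using settled a h by (auto simp: settled_def)
          then show "length (chosen h) = length (preferred h)" using success(1) by simp
          fix p assume "p < length (chosen h)"
          then have p: "p < deg N a" using ports by simp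
          obtain u q where u: "peer N (a, p) = (u, q)" by fastforce
          note u' = simple_network_peer[OF simple a p u]
          have "chosen (st u) ! q \<noteq> preferred h ! p" using success(2)[OF _ _ p u] s0 u' by simp
          moreover have "chosen h ! p \<noteq> chosen (st u) ! q"
            using settled a p u h by (auto simp: settled_def)
          ultimately show "chosen h ! p = preferred h ! p" by (blast intro: opposite_of_opposite)
        qed
        then show "measure_pmf.prob (attack_run ?\<Lambda> N a A t ?s0)
            {s. utility N a (preferred h) (attack_outputs a s) = 1} \<le> ?c"
          by (auto simp: measure_le_0_iff measure_pmf_zero_iff)
      qed simp
      also have "\<dots> \<le> honest_utility \<sigma> \<tau> ids ?\<Lambda> r h"
      proof (rule honest_utility_ge)
        fix N a st assume "(N, a, st) \<in> set_pmf (posterior \<sigma> \<tau> ids ?\<Lambda> r h)"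
        then obtain prof where start: "possible_start \<sigma> ids N prof" and a: "a < net_size N"
          and h: "st a = h" and st: "st \<in> set_pmf (honest_run coin_tossing N (Suc r') (initial N prof))"
          using posterior Suc by blast
        have simple: "simple_links (half_edges N) (peer N)"
          using start by (auto simp: possible_start_def two_connected_network_def)
        have "utility N a (chosen h) (\<lambda>v. decided (st' v)) = 1"
          if "st' \<in> set_pmf (honest_run coin_tossing N 1 st)" for st'
          using utility_after_step[OF settled_honest_run[OF start st] that simple a] h by simp
        then have "chosen h = preferred h \<Longrightarrow> measure_pmf.prob (honest_run coin_tossing N 1 st)
            {st'. utility N a (preferred h) (\<lambda>v. decided (st' v)) = 1} = 1"
          by (subst measure_pmf.prob_eq_1) (auto simp: AE_measure_pmf_iff simp del: honest_run.simps)
        then show "?c \<le> measure_pmf.prob (honest_run ?\<Lambda> N 1 st)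
            {st'. utility N a (preferred h) (\<lambda>v. decided (st' v)) = 1}"
          unfolding honest_run_detecting_from[OF start st] by simp
      qed
      finally show ?thesis .
    qed
  qed
  then show "orientation_equilibrium \<sigma> ids ?\<Lambda>"
    by (simp add: orientation_equilibrium_def solves_orientation_detecting
        solves_orientation_coin_tossing aborts_on_detection_detecting)
qed

end
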